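(* Let $G$ be a finite group, let $H\le G$ be a subgroup, and let $A$ be a multiset of cardinality $|G|$ all of whose elements lie in $H$. Then $A$ is quotient-realizable in $G$ if and only if $A$ can be partitioned, as a multiset, into $[G:H]$ submultisets $A_1,\ldots,A_{[G:H]}$ with $|A_j|=|H|$ for every $j$, such that each $A_j$ is quotient-realizable in $H$.
   Context: All multisets are counted with multiplicity; groups are written multiplicatively. For a finite group $\Gamma$, a multiset $B$ of cardinality $|\Gamma|$ with elements in $\Gamma$ is quotient-realizable in $\Gamma$ if there exist bijections $b,c:\{1,\ldots,|\Gamma|\}\to \Gamma$ such that $B=\{b(i)c(i)^{-1}:1\le i\le |\Gamma|\}$ as multisets. A partition of a multiset into submultisets means that it is their multiset sum (multiplicities add). *)

theory Defs
  imports "HOL-Algebra.Coset" "HOL-Library.Multiset"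
begin

text \<open>The equation for \<open>B\<close> already forces \<open>B\<close> to have size \<open>order \<Gamma>\<close> and, in a group,
  to have all its elements in \<open>carrier \<Gamma>\<close>.\<close>

definition quotient_realizable :: "('a, 'b) monoid_scheme \<Rightarrow> 'a multiset \<Rightarrow> bool" where
  "quotient_realizable \<Gamma> B \<longleftrightarrow>
     (\<exists>b c. bij_betw b {1..order \<Gamma>} (carrier \<Gamma>) \<and>
            bij_betw c {1..order \<Gamma>} (carrier \<Gamma>) \<and>
            B = {# b i \<otimes>\<^bsub>\<Gamma>\<^esub> inv\<^bsub>\<Gamma>\<^esub> (c i). i \<in># mset_set {1..order \<Gamma>} #})"

definition subgroup_index :: "('a, 'b) monoid_scheme \<Rightarrow> 'a set \<Rightarrow> nat" where
  "subgroup_index G H = card (rcosets\<^bsub>G\<^esub> H)"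

end

theory Submission imports Defs "HOL-Library.Disjoint_Sets" begin

text \<open>If \<open>b i \<otimes> inv (c i) \<in> H\<close> then \<open>b i\<close> and \<open>c i\<close> lie in the same right coset of \<open>H\<close>, so the
  permutation of \<open>G\<close> taking \<open>c i\<close> to \<open>b i\<close> restricts to a permutation of each right coset
  \<open>H g\<close>. Quotients are invariant under right translation, so translating by \<open>inv g\<close> turns
  permutations of \<open>H g\<close> into permutations of \<open>H\<close> with the same quotients.\<close>

text \<open>The index set only serves to pair \<open>c i\<close> with \<open>b i\<close>, so all
  that matters is the map taking \<open>c i\<close> to \<open>b i\<close>. The labelling
  \<open>f\<close> transports this map to a permutation of \<open>S\<close>; below, \<open>S\<close>
  is either the group itself or a right coset translated onto the subgroup.\<close>

lemma quotient_realizable_iff_permutation: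
  assumes fin: "finite (carrier \<Gamma>)" and f: "bij_betw f S (carrier \<Gamma>)"
  shows "quotient_realizable \<Gamma> B \<longleftrightarrow>
    (\<exists>\<sigma>. bij_betw \<sigma> S S \<and> B = {# f (\<sigma> x) \<otimes>\<^bsub>\<Gamma>\<^esub> inv\<^bsub>\<Gamma>\<^esub> (f x). x \<in># mset_set S #})"
proof
  assume "quotient_realizable \<Gamma> B"
  then obtain b c where b: "bij_betw b {1..order \<Gamma>} (carrier \<Gamma>)"
    and c: "bij_betw c {1..order \<Gamma>} (carrier \<Gamma>)"
    and B: "B = {# b i \<otimes>\<^bsub>\<Gamma>\<^esub> inv\<^bsub>\<Gamma>\<^esub> (c i). i \<in># mset_set {1..order \<Gamma>} #}"
    unfolding quotient_realizable_def by blast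
  \<comment> \<open>\<open>d x\<close> is the index at which \<open>c\<close> takes the value
    \<open>f x\<close>. Reindexing along \<open>d\<close> therefore turns \<open>c\<close> into
    \<open>f\<close>, and \<open>\<sigma>\<close> is \<open>b \<circ> d\<close> pulled back to
    \<open>S\<close> through \<open>f\<close>.\<close>
  define d where "d = inv_into {1..order \<Gamma>} c \<circ> f"
  have d: "bij_betw d S {1..order \<Gamma>}"
    unfolding d_def using bij_betw_inv_into[OF c] f by (rule bij_betw_trans[rotated])
  define \<sigma> where "\<sigma> = inv_into S f \<circ> (b \<circ> d)"
  have "bij_betw \<sigma> S S"
    unfolding \<sigma>_def by (intro bij_betw_trans[OF bij_betw_trans[OF d b]] bij_betw_inv_into f)
  moreover have "B = {# f (\<sigma> x) \<otimes>\<^bsub>\<Gamma>\<^esub> inv\<^bsub>\<Gamma>\<^esub> (f x). x \<in># mset_set S #}"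
  proof -
    have "B = {# b (d x) \<otimes>\<^bsub>\<Gamma>\<^esub> inv\<^bsub>\<Gamma>\<^esub> (c (d x)). x \<in># mset_set S #}"
      unfolding B bij_betw_imp_surj_on[OF d, symmetric]
        image_mset_mset_set[OF bij_betw_imp_inj_on[OF d], symmetric]
      by (simp add: multiset.map_comp comp_def)
    also have "\<dots> = {# f (\<sigma> x) \<otimes>\<^bsub>\<Gamma>\<^esub> inv\<^bsub>\<Gamma>\<^esub> (f x). x \<in># mset_set S #}"
    proof (rule image_mset_cong)
      fix x assume "x \<in># mset_set S"
      then have x: "x \<in> S" using fin bij_betw_finite[OF f] by simp
      have "c (d x) = f x"
        unfolding d_def using bij_betw_inv_into_right[OF c] bij_betwE[OF f] x by simp
      moreover have "f (\<sigma> x) = b (d x)"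
        unfolding \<sigma>_def using bij_betw_inv_into_right[OF f] bij_betwE[OF b] bij_betwE[OF d] x by simp
      ultimately show "b (d x) \<otimes>\<^bsub>\<Gamma>\<^esub> inv\<^bsub>\<Gamma>\<^esub> (c (d x)) = f (\<sigma> x) \<otimes>\<^bsub>\<Gamma>\<^esub> inv\<^bsub>\<Gamma>\<^esub> (f x)"
        by simp
    qed
    finally show ?thesis .
  qed
  ultimately show "\<exists>\<sigma>. bij_betw \<sigma> S S \<and>
      B = {# f (\<sigma> x) \<otimes>\<^bsub>\<Gamma>\<^esub> inv\<^bsub>\<Gamma>\<^esub> (f x). x \<in># mset_set S #}" by blast
next
  assume "\<exists>\<sigma>. bij_betw \<sigma> S S \<and>
      B = {# f (\<sigma> x) \<otimes>\<^bsub>\<Gamma>\<^esub> inv\<^bsub>\<Gamma>\<^esub> (f x). x \<in># mset_set S #}"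
  then obtain \<sigma> where \<sigma>: "bij_betw \<sigma> S S"
    and B: "B = {# f (\<sigma> x) \<otimes>\<^bsub>\<Gamma>\<^esub> inv\<^bsub>\<Gamma>\<^esub> (f x). x \<in># mset_set S #}" by blast
  \<comment> \<open>Any enumeration \<open>g\<close> of \<open>S\<close> will do:
    \<open>f \<circ> g\<close> plays the role of \<open>c\<close>, and
    \<open>f \<circ> (\<sigma> \<circ> g)\<close> that of \<open>b\<close>.\<close>
  obtain g where g: "bij_betw g {1..order \<Gamma>} S"
    using finite_same_card_bij[of "{1..order \<Gamma>}" S] fin bij_betw_finite[OF f]
      bij_betw_same_card[OF f] by (auto simp: order_def)
  have "bij_betw (f \<circ> g) {1..order \<Gamma>} (carrier \<Gamma>)"
    "bij_betw (f \<circ> (\<sigma> \<circ> g)) {1..order \<Gamma>} (carrier \<Gamma>)"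
    by (intro bij_betw_trans[OF _ f] bij_betw_trans[OF g \<sigma>] g)+
  moreover have "B = {# (f \<circ> (\<sigma> \<circ> g)) i \<otimes>\<^bsub>\<Gamma>\<^esub> inv\<^bsub>\<Gamma>\<^esub> ((f \<circ> g) i). i \<in># mset_set {1..order \<Gamma>} #}"
    unfolding B bij_betw_imp_surj_on[OF g, symmetric]
      image_mset_mset_set[OF bij_betw_imp_inj_on[OF g], symmetric]
    by (simp add: multiset.map_comp comp_def)
  ultimately show "quotient_realizable \<Gamma> B"
    unfolding quotient_realizable_def by blast
qed

text \<open>Right translation by \<open>inv g\<close> identifies \<open>C = H #> g\<close> with
  \<open>H\<close> and cancels in every quotient. Since \<open>C\<close> is absent from the
  left-hand side, a multiset realizable in \<open>H\<close> can be realized on whichever right coset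
  is wanted.\<close>

lemma (in group) quotient_realizable_subgroup_iff:
  assumes fin: "finite (carrier G)" and H: "subgroup H G" and C: "C \<in> rcosets H"
  shows "quotient_realizable (G\<lparr>carrier := H\<rparr>) B \<longleftrightarrow>
    (\<exists>\<sigma>. bij_betw \<sigma> C C \<and> B = {# \<sigma> x \<otimes> inv x. x \<in># mset_set C #})"
proof -
  have HG: "H \<subseteq> carrier G" using H by (rule subgroup.subset)
  have CG: "C \<subseteq> carrier G" using rcosets_subset_PowG[OF H] C by blast
  obtain g where g: "g \<in> carrier G" and Cg: "C = H #> g"
    using C unfolding RCOSETS_def by blast
  have f: "bij_betw (\<lambda>x. x \<otimes> inv g) C (carrier (G\<lparr>carrier := H\<rparr>))"
  proof (rule bij_betw_byWitness[where f' = "\<lambda>h. h \<otimes> g"])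
    show "\<forall>x\<in>C. x \<otimes> inv g \<otimes> g = x" using CG g by (auto simp: m_assoc)
    show "\<forall>h\<in>carrier (G\<lparr>carrier := H\<rparr>). h \<otimes> g \<otimes> inv g = h"
      using HG g by (auto simp: m_assoc)
    show "(\<lambda>x. x \<otimes> inv g) ` C \<subseteq> carrier (G\<lparr>carrier := H\<rparr>)"
      using HG g unfolding Cg r_coset_def by (auto simp: m_assoc subset_iff)
    show "(\<lambda>h. h \<otimes> g) ` carrier (G\<lparr>carrier := H\<rparr>) \<subseteq> C"
      unfolding Cg r_coset_def by auto
  qed
  have finC: "finite C" using CG fin by (rule finite_subset)
  have eq: "{# \<sigma> x \<otimes> inv g \<otimes> inv\<^bsub>G\<lparr>carrier := H\<rparr>\<^esub> (x \<otimes> inv g). x \<in># mset_set C #}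
      = {# \<sigma> x \<otimes> inv x. x \<in># mset_set C #}" if \<sigma>: "bij_betw \<sigma> C C" for \<sigma>
  proof (rule image_mset_cong)
    fix x assume "x \<in># mset_set C"
    then have x: "x \<in> C" using finC by simp
    then have xG: "x \<in> carrier G" "\<sigma> x \<in> carrier G" using bij_betwE[OF \<sigma>] CG by blast+
    \<comment> \<open>Membership in \<open>H\<close> is what lets the inverse taken in
      \<open>G\<lparr>carrier := H\<rparr>\<close> be replaced by the inverse in
      \<open>G\<close>.\<close>
    have "x \<otimes> inv g \<in> H" using bij_betwE[OF f] x by simp
    then have "inv\<^bsub>G\<lparr>carrier := H\<rparr>\<^esub> (x \<otimes> inv g) = g \<otimes> inv x"
      using m_inv_consistent[OF H] xG g by (simp add: inv_mult_group)
    moreover have "inv g \<otimes> (g \<otimes> inv x) = inv x"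
      using xG g by (simp flip: m_assoc)
    ultimately show "\<sigma> x \<otimes> inv g \<otimes> inv\<^bsub>G\<lparr>carrier := H\<rparr>\<^esub> (x \<otimes> inv g) = \<sigma> x \<otimes> inv x"
      using xG g by (simp add: m_assoc)
  qed
  \<comment> \<open>The equation \<open>eq\<close> holds for permutations of \<open>C\<close>;
    \<open>conj_cong\<close> makes the first conjunct available when it rewrites the second.\<close>
  show ?thesis
    using quotient_realizable_iff_permutation[OF _ f, of B] finite_subset[OF HG fin] eq
    by (auto cong: conj_cong)
qed

text \<open>Disjointness ensures that no point of the union is counted by two summands. This cuts
  the quotients of a permutation of \<open>G\<close> into the contributions of the cosets.\<close>

lemma image_mset_mset_set_UNION:
  assumes "finite I" and "\<And>i. i \<in> I \<Longrightarrow> finite (S i)" and "disjoint_family_on S I"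
  shows "image_mset f (mset_set (\<Union>i\<in>I. S i)) = (\<Sum>i\<in>I. image_mset f (mset_set (S i)))"
  using assms
proof (induction I)
  case (insert i I)
  then have "S i \<inter> (\<Union>i\<in>I. S i) = {}" by (auto simp: disjoint_family_on_def)
  with insert show ?case
    by (simp add: mset_set_Union disjoint_family_on_mono[of I "insert i I"] subset_insertI)
qed simp

theorem theorem4p1:
  fixes G :: "('a, 'b) monoid_scheme" and H :: "'a set" and A :: "'a multiset"
  assumes "group G" and "finite (carrier G)" and "subgroup H G"
    and "size A = order G" and "set_mset A \<subseteq> H"
  shows "quotient_realizable G A \<longleftrightarrow>
    (\<exists>P :: nat \<Rightarrow> 'a multiset.
       A = (\<Sum>j\<in>{1..subgroup_index G H}. P j) \<and>
       (\<forall>j\<in>{1..subgroup_index G H}.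
          size (P j) = card H \<and> quotient_realizable (G\<lparr>carrier := H\<rparr>) (P j)))"
proof -
  interpret group G by fact
  note fin = assms(2) and H = assms(3)
  define J where "J = {1..subgroup_index G H}"
  have finJ: "finite J" unfolding J_def by simp
  have HG: "H \<subseteq> carrier G" using H by (rule subgroup.subset)
  have CG: "C \<subseteq> carrier G" if "C \<in> rcosets\<^bsub>G\<^esub> H" for C
    using rcosets_subset_PowG[OF H] that by blast
  have "finite (rcosets\<^bsub>G\<^esub> H)" using fin rcosets_subset_PowG[OF H] by (meson finite_Pow_iff finite_subset)
  \<comment> \<open>\<open>e\<close> numbers the right cosets, so that the \<open>j\<close>-th
    submultiset can be attached to the coset \<open>e j\<close>.\<close>
  then obtain e where e: "bij_betw e J (rcosets\<^bsub>G\<^esub> H)"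
    using finite_same_card_bij[of J "rcosets\<^bsub>G\<^esub> H"] unfolding J_def subgroup_index_def by auto
  have eC: "e j \<in> rcosets\<^bsub>G\<^esub> H" if "j \<in> J" for j using bij_betwE[OF e] that by blast
  have fine: "finite (e j)" if "j \<in> J" for j using CG[OF eC[OF that]] fin by (rule finite_subset)
  have Un: "(\<Union>j\<in>J. e j) = carrier G"
    using rcosets_part_G[OF H] bij_betw_imp_surj_on[OF e] by simp
  have dis: "disjoint_family_on e J"
    unfolding disjoint_family_on_def
  proof (intro ballI impI)
    fix i j assume ij: "i \<in> J" "j \<in> J" "i \<noteq> j"
    then have "e i \<noteq> e j" using bij_betw_imp_inj_on[OF e] by (auto dest: inj_onD)
    with pairwiseD[OF rcos_disjoint[OF H] eC eC, OF ij(1,2)] show "e i \<inter> e j = {}"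
      by (simp add: disjnt_def)
  qed
  have split: "image_mset f (mset_set (carrier G)) = (\<Sum>j\<in>J. image_mset f (mset_set (e j)))"
    for f :: "'a \<Rightarrow> 'a"
    using image_mset_mset_set_UNION[OF finJ fine dis, of f] unfolding Un .
  have qrG: "quotient_realizable G A \<longleftrightarrow>
      (\<exists>\<sigma>. bij_betw \<sigma> (carrier G) (carrier G) \<and> A = {# \<sigma> x \<otimes>\<^bsub>G\<^esub> inv\<^bsub>G\<^esub> x. x \<in># mset_set (carrier G) #})"
    using quotient_realizable_iff_permutation[OF fin, of id "carrier G" A] by simp
  note qrH = quotient_realizable_subgroup_iff[OF fin H]
  show ?thesis
    unfolding J_def[symmetric]
  proof
    assume "quotient_realizable G A"
    then obtain \<sigma> where \<sigma>: "bij_betw \<sigma> (carrier G) (carrier G)"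
      and A: "A = {# \<sigma> x \<otimes>\<^bsub>G\<^esub> inv\<^bsub>G\<^esub> x. x \<in># mset_set (carrier G) #}" unfolding qrG by blast
    have \<sigma>e: "bij_betw \<sigma> (e j) (e j)" if j: "j \<in> J" for j
    proof -
      obtain g where g: "g \<in> carrier G" and eg: "e j = H #>\<^bsub>G\<^esub> g"
        using eC[OF j] unfolding RCOSETS_def by blast
      have "\<sigma> x \<in> e j" if x: "x \<in> e j" for x
      proof -
        have xG: "x \<in> carrier G" using x CG[OF eC[OF j]] by blast
        then have sG: "\<sigma> x \<in> carrier G" using bij_betwE[OF \<sigma>] by blast
        \<comment> \<open>Here the assumption that all elements of \<open>A\<close> lie in
          \<open>H\<close> enters: it forces \<open>\<sigma> x\<close> into the coset of
          \<open>x\<close>.\<close>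
        have "\<sigma> x \<otimes>\<^bsub>G\<^esub> inv\<^bsub>G\<^esub> x \<in> H" using assms(5) xG fin unfolding A by auto
        then have "\<sigma> x \<otimes>\<^bsub>G\<^esub> inv\<^bsub>G\<^esub> x \<otimes>\<^bsub>G\<^esub> x \<in> H #>\<^bsub>G\<^esub> x" unfolding r_coset_def by blast
        then have "\<sigma> x \<in> H #>\<^bsub>G\<^esub> x" using xG sG by (simp add: m_assoc)
        then show ?thesis using repr_independence[OF _ g H] x unfolding eg by simp
      qed
      \<comment> \<open>An injective self-map of the finite set \<open>e j\<close> is onto, so
        mapping \<open>e j\<close> into itself suffices.\<close>
      moreover have "inj_on \<sigma> (e j)"
        using bij_betw_imp_inj_on[OF \<sigma>] CG[OF eC[OF j]] by (rule inj_on_subset)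
      ultimately show ?thesis
        using endo_inj_surj[OF fine[OF j], of \<sigma>] by (auto simp: bij_betw_def)
    qed
    \<comment> \<open>\<open>P j\<close> collects the quotients arising on the coset
      \<open>e j\<close>; its size is that of the coset, which equals \<open>card H\<close>.\<close>
    define P where "P j = {# \<sigma> x \<otimes>\<^bsub>G\<^esub> inv\<^bsub>G\<^esub> x. x \<in># mset_set (e j) #}" for j
    have "A = (\<Sum>j\<in>J. P j)" unfolding A P_def by (rule split)
    moreover have "size (P j) = card H \<and> quotient_realizable (G\<lparr>carrier := H\<rparr>) (P j)"
      if j: "j \<in> J" for j
      using card_rcosets_equal[OF eC[OF j] HG] qrH[OF eC[OF j]] \<sigma>e[OF j] unfolding P_def by auto
    ultimately show "\<exists>P. A = (\<Sum>j\<in>J. P j) \<and>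
        (\<forall>j\<in>J. size (P j) = card H \<and> quotient_realizable (G\<lparr>carrier := H\<rparr>) (P j))" by blast
  next
    assume "\<exists>P. A = (\<Sum>j\<in>J. P j) \<and>
        (\<forall>j\<in>J. size (P j) = card H \<and> quotient_realizable (G\<lparr>carrier := H\<rparr>) (P j))"
    then obtain P where A: "A = (\<Sum>j\<in>J. P j)"
      and P: "\<And>j. j \<in> J \<Longrightarrow> quotient_realizable (G\<lparr>carrier := H\<rparr>) (P j)" by blast
    \<comment> \<open>Each \<open>P j\<close> is realized on its own coset, so that the permutations
      have disjoint domains and can be glued.\<close>
    have "\<forall>j\<in>J. \<exists>\<tau>. bij_betw \<tau> (e j) (e j) \<and> P j = {# \<tau> x \<otimes>\<^bsub>G\<^esub> inv\<^bsub>G\<^esub> x. x \<in># mset_set (e j) #}"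
      using P qrH[OF eC] by blast
    then obtain \<tau> where \<tau>: "\<And>j. j \<in> J \<Longrightarrow> bij_betw (\<tau> j) (e j) (e j)"
      and P\<tau>: "\<And>j. j \<in> J \<Longrightarrow> P j = {# \<tau> j x \<otimes>\<^bsub>G\<^esub> inv\<^bsub>G\<^esub> x. x \<in># mset_set (e j) #}" by metis
    \<comment> \<open>By disjointness of the cosets, the description picks the one index
      \<open>j\<close> with \<open>x \<in> e j\<close>, for \<open>x\<close> in the group; thus
      \<open>\<sigma>\<close> agrees with \<open>\<tau> j\<close> on \<open>e j\<close>.\<close>
    define \<sigma> where "\<sigma> x = \<tau> (THE j. j \<in> J \<and> x \<in> e j) x" for x
    have \<sigma>\<tau>: "\<sigma> x = \<tau> j x" if "j \<in> J" "x \<in> e j" for j x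
    proof -
      have "(THE j. j \<in> J \<and> x \<in> e j) = j"
        using that dis by (intro the_equality) (auto simp: disjoint_family_on_def)
      then show ?thesis unfolding \<sigma>_def by simp
    qed
    have \<sigma>e: "bij_betw \<sigma> (e j) (e j)" if "j \<in> J" for j
      using \<tau>[OF that] \<sigma>\<tau>[OF that] by (simp cong: bij_betw_cong)
    have "bij_betw \<sigma> (carrier G) (carrier G)"
      using bij_betw_UNION_disjoint[OF dis \<sigma>e] by (simp add: Un)
    moreover have "A = {# \<sigma> x \<otimes>\<^bsub>G\<^esub> inv\<^bsub>G\<^esub> x. x \<in># mset_set (carrier G) #}"
      unfolding A split
      by (intro sum.cong refl) (auto simp: P\<tau> \<sigma>\<tau> fine intro!: image_mset_cong)
    ultimately show "quotient_realizable G A" unfolding qrG by blast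
  qed
qed

end
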